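(* Among the Kneser graphs $K_{n:k}$ with integers $k\ge 1$ and $n>2k$, those with determining number $\mathrm{Det}(K_{n:k})=5$ are exactly: $K_{6:1}$, $K_{8:2}$, $K_{10:3}$, $K_{11:3}$, $K_{12:4}$, $K_{13:4}$, $K_{13:5}$, $K_{14:5}$, $K_{15:5}$, $K_{16:5}$, $K_{14:6}$, $K_{15:6}$, $K_{16:6}$, $K_{17:6}$, $K_{16:7}$, $K_{17:7}$, $K_{18:7}$, $K_{19:7}$, $K_{17:8}$, $K_{18:8}$, $K_{19:8}$, $K_{20:8}$, $K_{21:8}$, $K_{19:9}$, $K_{20:9}$, $K_{21:9}$, $K_{22:9}$, $K_{21:10}$, $K_{22:10}$, $K_{23:10}$, $K_{24:10}$, $K_{23:11}$, $K_{24:11}$, $K_{25:11}$, $K_{26:11}$, $K_{25:12}$, $K_{26:12}$, $K_{27:12}$, $K_{27:13}$, $K_{28:13}$, $K_{29:14}$, and $K_{31:15}$.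
   Context: The Kneser graph $K_{n:k}$ has as vertices the $k$-element subsets of $[n]=\{1,\ldots,n\}$, two vertices being adjacent exactly when they are disjoint as sets. A set $S\subseteq V(G)$ of vertices of a finite graph $G$ is a determining set of $G$ if whenever $g,h\in\mathrm{Aut}(G)$ satisfy $g(s)=h(s)$ for all $s\in S$, then $g(v)=h(v)$ for all $v\in V(G)$. The determining number $\mathrm{Det}(G)$ is the minimum cardinality of a determining set of $G$. *)

theory Defs
  imports "Graph_Theory.Pair_Digraph"
begin

text \<open>
  A finite simple graph is a \<^locale>\<open>pair_graph\<close>: an undirected edge
  is represented by both of its arcs.
\<close>

definition kneser_graph :: "nat \<Rightarrow> nat \<Rightarrow> nat set pair_pre_digraph" where
  "kneser_graph n k =
    (let V = {A. A \<subseteq> {1..n} \<and> card A = k}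
     in \<lparr> pverts = V, parcs = {(A, B). A \<in> V \<and> B \<in> V \<and> A \<inter> B = {}} \<rparr>)"

text \<open>
  Automorphisms are functions on the whole type; their values outside the vertex set
  are irrelevant, and two of them are the same automorphism iff they agree on the vertices.
\<close>

definition graph_automorphism :: "'a pair_pre_digraph \<Rightarrow> ('a \<Rightarrow> 'a) \<Rightarrow> bool" where
  "graph_automorphism G g \<longleftrightarrow>
     bij_betw g (pverts G) (pverts G) \<and>
     (\<forall>u \<in> pverts G. \<forall>v \<in> pverts G. (u, v) \<in> parcs G \<longleftrightarrow> (g u, g v) \<in> parcs G)"

definition determining_set :: "'a pair_pre_digraph \<Rightarrow> 'a set \<Rightarrow> bool" where
  "determining_set G S \<longleftrightarrow>
     S \<subseteq> pverts G \<and>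
     (\<forall>g h. graph_automorphism G g \<longrightarrow> graph_automorphism G h \<longrightarrow>
        (\<forall>s \<in> S. g s = h s) \<longrightarrow> (\<forall>v \<in> pverts G. g v = h v))"

text \<open>
  Meaningful for finite graphs only, since \<^const>\<open>card\<close> is 0 on infinite sets. The
  minimum exists because the whole vertex set is determining.
\<close>

definition determining_number :: "'a pair_pre_digraph \<Rightarrow> nat" where
  "determining_number G = (LEAST m. \<exists>S. determining_set G S \<and> card S = m)"

lemma determining_set_pverts: "determining_set G (pverts G)"
  by (auto simp: determining_set_def)

lemma pverts_kneser_graph: "pverts (kneser_graph n k) = {A. A \<subseteq> {1..n} \<and> card A = k}"
  by (simp add: kneser_graph_def Let_def)

lemma parcs_kneser_graph:
  "(A, B) \<in> parcs (kneser_graph n k) \<longleftrightarrow>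
     A \<in> pverts (kneser_graph n k) \<and> B \<in> pverts (kneser_graph n k) \<and> A \<inter> B = {}"
  by (simp add: kneser_graph_def Let_def)

text \<open>For \<open>k = 0\<close> the definition would produce a loop at the empty set.\<close>

lemma pair_graph_kneser_graph:
  assumes "k \<ge> 1"
  shows "pair_graph (kneser_graph n k)"
proof
  let ?G = "kneser_graph n k"
  show fin: "finite (pverts ?G)"
    unfolding pverts_kneser_graph by simp
  have "parcs ?G \<subseteq> pverts ?G \<times> pverts ?G"
    using parcs_kneser_graph by fast
  then show "finite (parcs ?G)"
    by (rule finite_subset) (intro finite_cartesian_product fin)
  fix e assume e: "e \<in> parcs ?G"
  obtain A B where AB: "e = (A, B)" by (cases e)
  show "fst e \<in> pverts ?G" "snd e \<in> pverts ?G"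
    using e by (simp_all add: AB parcs_kneser_graph)
  show "fst e \<noteq> snd e"
  proof
    assume "fst e = snd e"
    with e have "A = {}" "card A = k"
      by (auto simp: AB parcs_kneser_graph pverts_kneser_graph)
    with assms show False by simp
  qed
next
  have "sym (parcs (kneser_graph n k))"
    by (rule symI) (simp add: parcs_kneser_graph Int_commute)
  then show "symmetric (with_proj (kneser_graph n k))"
    unfolding symmetric_def with_proj_simps .
qed

end

theory Submission
  imports Defs "HOL-Combinatorics.Transposition"
begin

text \<open>
  Write \<open>K\<close> for the Kneser graph of the \<open>k\<close>-subsets of \<open>{1..n}\<close>, with \<open>n > 2k\<close>. Its
  automorphisms are exactly the maps \<open>A \<mapsto> p ` A\<close> for permutations \<open>p\<close> of the points
  (\<open>kneser_automorphism_induced\<close>): the number of common neighbours recognises the pairs of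
  vertices that differ by exchanging one point, and the cliques of that relation recover the
  \<open>(k - 1)\<close>-subsets, hence inductively the points themselves. So two points that lie in the same
  members of a set \<open>S\<close> of vertices can be transposed without moving any member of \<open>S\<close>, and \<open>S\<close> is
  determining exactly when no two points are so related (\<open>determining_set_kneser_iff\<close>).

  It remains to decide when at most \<open>m\<close> sets of size \<open>k\<close> can separate \<open>n\<close> points. Record for each
  point which of the \<open>m\<close> sets contain it: separation says that the \<open>n\<close> records are different subsets
  of an \<open>m\<close>-element set, and the sizes of the sets say that every one of the \<open>m\<close> elements occurs in
  exactly \<open>k\<close> records. The sizes of the records therefore add up to \<open>m k\<close>, which must be at least
  the total size of \<open>n\<close> smallest subsets. This obvious necessary condition is also sufficient,
  because a family of small enough total size can be changed one member at a time until all degrees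
  are \<open>k\<close> (\<open>regular_family_exists\<close>). The total size of \<open>n\<close> smallest subsets is the maximum over
  \<open>t \<le> m\<close> of \<open>t n - (\<Sum>j. (m choose j) * (t - j))\<close> with truncated \<open>t - j\<close>, so the criterion
  \<open>separating_family_iff\<close> is a system of inequalities linear in \<open>n\<close> and \<open>k\<close>. Determining number \<open>5\<close>
  means that the system for \<open>m = 5\<close> holds and that for \<open>m = 4\<close> fails; \<open>n > 2k\<close> then bounds \<open>k\<close>,
  and finitely many pairs remain.
\<close>

section \<open>Automorphisms of Kneser graphs\<close>

text \<open>
  Cliques of the relation ``differ by exchanging one point'' are of two kinds: all members contain a
  common \<open>k\<close>-set, or all members lie in a common \<open>(k + 2)\<close>-set. The second kind has at most \<open>k + 2\<close>
  members, so size alone excludes it.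
\<close>

lemma clique_common_core:
  assumes unif: "\<And>A. A \<in> \<F> \<Longrightarrow> finite A \<and> card A = Suc k"
    and adj: "\<And>A B. A \<in> \<F> \<Longrightarrow> B \<in> \<F> \<Longrightarrow> A \<noteq> B \<Longrightarrow> card (A \<inter> B) = k"
    and large: "k + 2 < card \<F>"
  shows "\<exists>C. card C = k \<and> (\<forall>A \<in> \<F>. C \<subseteq> A)"
proof -
  have "\<not> card \<F> \<le> Suc 0" using large by simp
  moreover have "finite \<F>" using large card.infinite by fastforce
  ultimately obtain A B where AB: "A \<in> \<F>" "B \<in> \<F>" "A \<noteq> B"
    by (meson card_le_Suc0_iff_eq)
  define C where "C = A \<inter> B"
  have finA: "finite A" and finB: "finite B" and cA: "card A = Suc k" and cB: "card B = Suc k"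
    using unif AB by auto
  have cC: "card C = k" unfolding C_def using adj AB by blast
  have cU: "card (A \<union> B) = k + 2"
    using card_Un_Int[OF finA finB] cA cB cC by (simp add: C_def)
  obtain E where E: "E \<in> \<F>" "\<not> E \<subseteq> A \<union> B"
  proof (rule ccontr)
    assume "\<not> thesis"
    then have "\<F> \<subseteq> {D. D \<subseteq> A \<union> B \<and> card D = Suc k}" using that unif by blast
    then have "card \<F> \<le> card {D. D \<subseteq> A \<union> B \<and> card D = Suc k}"
      by (rule card_mono[rotated]) (use finA finB in auto)
    also have "\<dots> = (k + 2) choose Suc k"
      using n_subsets[of "A \<union> B" "Suc k"] finA finB cU by simp
    also have "\<dots> = k + 2" using binomial_Suc_n[of "Suc k"] by simp
    finally show False using large by simp
  qed
  have finE: "finite E" and cE: "card E = Suc k" using unif E by auto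
  have EAB: "E \<noteq> A" "E \<noteq> B" using E by auto
  have CE: "C \<subseteq> E"
  proof -
    have "card (E \<inter> (A \<union> B)) < card E"
      by (rule psubset_card_mono) (use finE E in auto)
    then have le: "card (E \<inter> (A \<union> B)) \<le> k" using cE by simp
    have "E \<inter> A = E \<inter> (A \<union> B)"
      by (rule card_seteq) (use finE le adj[OF E(1) AB(1) EAB(1)] in auto)
    moreover have "E \<inter> B = E \<inter> (A \<union> B)"
      by (rule card_seteq) (use finE le adj[OF E(1) AB(2) EAB(2)] in auto)
    ultimately have "E \<inter> A \<subseteq> C" unfolding C_def by blast
    then have "E \<inter> A = C"
      by (rule card_seteq[rotated]) (simp_all add: C_def finA cC[unfolded C_def] adj[OF E(1) AB(1) EAB(1)])
    then show ?thesis by blast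
  qed
  have "C \<subseteq> D" if D: "D \<in> \<F>" for D
  proof (rule ccontr)
    assume nC: "\<not> C \<subseteq> D"
    have finD: "finite D" and cD: "card D = Suc k" using unif D by auto
    have finC: "finite C" using finA by (simp add: C_def)
    \<comment> \<open>Lacking a point of \<open>C\<close>, the set \<open>D\<close> must contain the extra point of every member above \<open>C\<close>;
      three such members leave too little room in \<open>D\<close>.\<close>
    have *: "\<exists>z. z \<in> D \<and> Z = insert z C \<and> z \<notin> C" if Z: "Z \<in> \<F>" "C \<subseteq> Z" for Z
    proof -
      have finZ: "finite Z" "card Z = Suc k" using unif Z by auto
      have "card (Z - C) = 1" using finZ Z cC finC by (simp add: card_Diff_subset)
      then obtain z where z: "Z - C = {z}" by (meson card_1_singletonE)
      have "z \<in> D"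
      proof (rule ccontr)
        assume "z \<notin> D"
        then have "D \<inter> Z \<subseteq> C" using z by auto
        moreover have "D \<inter> Z \<noteq> C" using nC by blast
        ultimately have "D \<inter> Z \<subset> C" by blast
        then have "card (D \<inter> Z) < k" using psubset_card_mono[OF finC] cC by metis
        moreover have "D \<noteq> Z" using nC Z by blast
        ultimately show False using adj[OF D Z(1)] by simp
      qed
      then show ?thesis using z Z(2) by blast
    qed
    have CA: "C \<subseteq> A" and CB: "C \<subseteq> B" by (simp_all add: C_def)
    obtain a where a: "a \<in> D" "A = insert a C" "a \<notin> C" using *[OF AB(1) CA] by blast
    obtain b where b: "b \<in> D" "B = insert b C" "b \<notin> C" using *[OF AB(2) CB] by blast
    obtain e where e: "e \<in> D" "E = insert e C" "e \<notin> C" using *[OF E(1) CE] by blast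
    have ne: "a \<noteq> b" "a \<noteq> e" "b \<noteq> e" using a(2) b(2) e(2) AB(3) EAB by metis+
    have "D \<inter> A = insert a (D \<inter> C)" using a by blast
    moreover have "D \<noteq> A" using nC CA by blast
    ultimately have "k = Suc (card (D \<inter> C))" using adj[OF D AB(1)] a(3) finD by simp
    moreover have "card ({a, b, e} \<union> (D \<inter> C)) = 3 + card (D \<inter> C)"
      using ne a(3) b(3) e(3) finD by simp
    moreover have "card ({a, b, e} \<union> (D \<inter> C)) \<le> card D"
      by (rule card_mono) (use a(1) b(1) e(1) finD in auto)
    ultimately show False using cD by simp
  qed
  with cC show ?thesis by blast
qed

text \<open>
  Induction on \<open>k\<close>. The sets above a fixed \<open>k\<close>-set \<open>C\<close> form a clique (its star) of more than
  \<open>k + 2\<close> members, which an automorphism \<open>g\<close> of the graph on \<open>(k + 1)\<close>-sets can only map to another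
  star. So \<open>g\<close> acts on the \<open>k\<close>-sets, and this action again respects the exchange relation, since two
  \<open>k\<close>-sets are related exactly when their stars meet. The hypothesis \<open>2 * k < card X\<close> is what makes
  stars larger than the other cliques. Adjacency is stated with the union because that is the
  quantity that common neighbours in a Kneser graph depend on.
\<close>

lemma johnson_automorphism_induced:
  fixes X :: "'a set" and g :: "'a set \<Rightarrow> 'a set"
  assumes "finite X" "1 \<le> k" "2 * k < card X"
    and "bij_betw g {A. A \<subseteq> X \<and> card A = k} {A. A \<subseteq> X \<and> card A = k}"
    and "\<And>A B. A \<subseteq> X \<Longrightarrow> card A = k \<Longrightarrow> B \<subseteq> X \<Longrightarrow> card B = k \<Longrightarrow>
           card (A \<union> B) = k + 1 \<longleftrightarrow> card (g A \<union> g B) = k + 1"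
  shows "\<exists>p. bij_betw p X X \<and> (\<forall>A. A \<subseteq> X \<longrightarrow> card A = k \<longrightarrow> g A = p ` A)"
  using assms(2-)
proof (induction k arbitrary: g rule: dec_induct)
  case base
  let ?V = "{A. A \<subseteq> X \<and> card A = 1}"
  have "bij_betw (\<lambda>x. {x}) X ?V"
    by (rule bij_betwI') (auto simp: card_1_singleton_iff)
  moreover define p where "p = (\<lambda>x. the_elem (g {x}))"
  have sing: "g {x} = {p x}" if "x \<in> X" for x
  proof -
    have "g {x} \<in> ?V" using bij_betwE[OF base(2)] that by auto
    then show ?thesis by (auto simp: p_def card_1_singleton_iff)
  qed
  have "p ` X \<subseteq> X"
  proof (rule image_subsetI)
    fix x assume x: "x \<in> X"
    then have "g {x} \<in> ?V" using bij_betwE[OF base(2)] by auto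
    then show "p x \<in> X" using sing[OF x] by simp
  qed
  moreover have "inj_on p X"
  proof (rule inj_onI)
    fix x y assume xy: "x \<in> X" "y \<in> X" "p x = p y"
    then have "g {x} = g {y}" using sing by simp
    then have "{x} = {y}"
      using inj_onD[OF bij_betw_imp_inj_on[OF base(2)], of "{x}" "{y}"] xy by auto
    then show "x = y" by simp
  qed
  ultimately have "bij_betw p X X" using endo_inj_surj[OF assms(1)] by (simp add: bij_betw_def)
  moreover have "g A = p ` A" if "A \<subseteq> X" "card A = 1" for A
  proof -
    from that obtain x where "A = {x}" by (auto simp: card_1_singleton_iff)
    then show ?thesis using sing that by auto
  qed
  ultimately show ?case by blast
next
  case (step k)
  let ?V = "{A. A \<subseteq> X \<and> card A = Suc k}"
  let ?W = "{C. C \<subseteq> X \<and> card C = k}"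
  note bij = step.prems(2)
  have finsub: "finite A" if "A \<subseteq> X" for A using that assms(1) finite_subset by blast
  define star where "star C = {A. A \<subseteq> X \<and> card A = Suc k \<and> C \<subseteq> A}" for C
  have star_eq: "star C = (\<lambda>x. insert x C) ` (X - C)" if C: "C \<in> ?W" for C
  proof
    show "star C \<subseteq> (\<lambda>x. insert x C) ` (X - C)"
    proof
      fix A assume "A \<in> star C"
      then have A: "A \<subseteq> X" "card A = Suc k" "C \<subseteq> A" by (auto simp: star_def)
      then have "card (A - C) = 1" using C finsub by (simp add: card_Diff_subset)
      then obtain x where "A - C = {x}" by (meson card_1_singletonE)
      then have "A = insert x C" "x \<in> X - C" using A by auto
      then show "A \<in> (\<lambda>x. insert x C) ` (X - C)" by blast
    qed
    show "(\<lambda>x. insert x C) ` (X - C) \<subseteq> star C"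
      using C finsub by (auto simp: star_def)
  qed
  have card_star: "card (star C) = card X - k" if C: "C \<in> ?W" for C
  proof -
    have "inj_on (\<lambda>x. insert x C) (X - C)" by (auto intro!: inj_onI)
    then show ?thesis
      using C finsub by (simp add: star_eq[OF C] card_image card_Diff_subset)
  qed
  have fin_star: "finite (star C)" for C
    by (rule finite_subset[of _ "Pow X"]) (use assms(1) in \<open>auto simp: star_def\<close>)
  have Int_star: "card (A \<inter> B) = k"
    if st: "A \<in> star C" "B \<in> star C" "A \<noteq> B" "C \<in> ?W" for A B C
  proof -
    obtain x where x: "A = insert x C" "x \<notin> C" using st(1) star_eq[OF st(4)] by blast
    obtain y where y: "B = insert y C" "y \<notin> C" using st(2) star_eq[OF st(4)] by blast
    have "A \<inter> B = C" using x y st(3) by auto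
    then show ?thesis using st(4) by simp
  qed
  have Un_iff: "card (A \<union> B) = Suc k + 1 \<longleftrightarrow> card (A \<inter> B) = k" if "A \<in> ?V" "B \<in> ?V" for A B
    using card_Un_Int[of A B] that finsub by auto
  have star_inj: "C = C'" if CC': "C \<in> ?W" "C' \<in> ?W" "star C = star C'" for C C'
  proof -
    have "2 \<le> card (star C)" using card_star[OF CC'(1)] step.prems(1) by simp
    then have "\<not> card (star C) \<le> Suc 0" by simp
    then obtain A B where AB: "A \<in> star C" "B \<in> star C" "A \<noteq> B"
      using fin_star by (meson card_le_Suc0_iff_eq)
    have "D = A \<inter> B" if D: "D \<in> ?W" "A \<in> star D" "B \<in> star D" for D
    proof (rule card_subset_eq)
      show "finite (A \<inter> B)" using D(2) finsub by (simp add: star_def)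
      show "D \<subseteq> A \<inter> B" using D by (simp add: star_def)
      show "card D = card (A \<inter> B)" using Int_star[OF D(2,3) AB(3) D(1)] D(1) by simp
    qed
    then show ?thesis using AB CC' by metis
  qed
  have gV: "g A \<in> ?V" if "A \<in> ?V" for A using bij_betwE[OF bij] that by blast
  have star_V: "star C \<subseteq> ?V" for C by (auto simp: star_def)
  have "\<exists>C'. C' \<in> ?W \<and> g ` star C = star C'" if C: "C \<in> ?W" for C
  proof -
    have inj: "inj_on g (star C)"
      by (rule inj_on_subset[OF bij_betw_imp_inj_on[OF bij] star_V])
    have cg: "card (g ` star C) = card X - k" using card_image[OF inj] card_star[OF C] by simp
    have "\<And>A. A \<in> g ` star C \<Longrightarrow> finite A \<and> card A = Suc k"
    proof -
      fix A assume "A \<in> g ` star C"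
      then obtain A' where "A' \<in> star C" "A = g A'" by blast
      then have "A \<in> ?V" using gV star_V by blast
      then show "finite A \<and> card A = Suc k" using finsub by blast
    qed
    moreover have "card (A \<inter> B) = k" if AB: "A \<in> g ` star C" "B \<in> g ` star C" "A \<noteq> B" for A B
    proof -
      obtain A' B' where *: "A = g A'" "B = g B'" "A' \<in> star C" "B' \<in> star C" "A' \<noteq> B'"
        using AB by blast
      then have V: "A' \<in> ?V" "B' \<in> ?V" using star_V by blast+
      have "card (A' \<union> B') = Suc k + 1" using Int_star[OF *(3-5) C] Un_iff V by blast
      then have "card (g A' \<union> g B') = Suc k + 1" using step.prems(3)[of A' B'] V by simp
      then show ?thesis using Un_iff gV V * by blast
    qed
    moreover have "k + 2 < card (g ` star C)" using cg step.prems(1) by simp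
    ultimately have "\<exists>D. card D = k \<and> (\<forall>A \<in> g ` star C. D \<subseteq> A)"
      by (rule clique_common_core)
    then obtain D where cD: "card D = k" and "\<forall>A \<in> g ` star C. D \<subseteq> A" by (elim exE conjE)
    then have sub: "D \<subseteq> g A" if "A \<in> star C" for A using that by simp
    have "star C \<noteq> {}" using card_star[OF C] step.prems(1) by (intro notI) simp
    then obtain A where A: "A \<in> star C" by blast
    then have "A \<in> ?V" using star_V by (rule subsetD[rotated])
    then have "g A \<subseteq> X" using gV by blast
    then have DX: "D \<in> ?W" using cD sub[OF A] by simp
    have "g ` star C \<subseteq> star D"
    proof (rule image_subsetI)
      fix B assume B: "B \<in> star C"
      then have "B \<in> ?V" using star_V by (rule subsetD[rotated])
      then show "g B \<in> star D" using gV[of B] sub[OF B] by (simp add: star_def)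
    qed
    then have "g ` star C = star D"
      using card_subset_eq[OF fin_star] cg card_star[OF DX] by metis
    with DX show ?thesis by (intro exI[of _ D] conjI)
  qed
  then have "\<forall>C \<in> ?W. \<exists>C'. C' \<in> ?W \<and> g ` star C = star C'" by (rule ballI)
  from bchoice[OF this] obtain g' where "\<forall>C \<in> ?W. g' C \<in> ?W \<and> g ` star C = star (g' C)" ..
  then have g': "g' C \<in> ?W \<and> g ` star C = star (g' C)" if "C \<in> ?W" for C
    using that by (rule bspec)
  have inj_g': "inj_on g' ?W"
  proof (rule inj_onI)
    fix C D assume CD: "C \<in> ?W" "D \<in> ?W" "g' C = g' D"
    then have "g ` star C = g ` star D" using g' by simp
    then have "star C = star D"
      by (rule inj_on_image_eq_iff[OF bij_betw_imp_inj_on[OF bij] star_V star_V, THEN iffD1])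
    then show "C = D" by (rule star_inj[OF CD(1,2)])
  qed
  have "finite ?W" by (rule finite_subset[of _ "Pow X"]) (use assms(1) in auto)
  moreover have "g' ` ?W \<subseteq> ?W" using g' by blast
  ultimately have bij': "bij_betw g' ?W ?W"
    unfolding bij_betw_def using inj_g' by (intro conjI endo_inj_surj)
  have meet: "card (C \<union> D) = k + 1 \<longleftrightarrow> C \<noteq> D \<and> star C \<inter> star D \<noteq> {}"
    if CD: "C \<in> ?W" "D \<in> ?W" for C D
  proof
    assume "card (C \<union> D) = k + 1"
    then have "C \<union> D \<in> star C \<inter> star D" "C \<noteq> D" using CD by (auto simp: star_def)
    then show "C \<noteq> D \<and> star C \<inter> star D \<noteq> {}" by blast
  next
    assume *: "C \<noteq> D \<and> star C \<inter> star D \<noteq> {}"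
    then obtain A where A: "A \<subseteq> X" "card A = Suc k" "C \<union> D \<subseteq> A" by (auto simp: star_def)
    have "card (C \<union> D) \<le> Suc k" using card_mono[of A "C \<union> D"] A finsub by metis
    moreover have "card C < card (C \<union> D)"
    proof (rule psubset_card_mono)
      show "finite (C \<union> D)" using CD finsub by simp
      have "\<not> D \<subseteq> C" using * card_subset_eq[of C D] CD finsub by auto
      then show "C \<subset> C \<union> D" by blast
    qed
    ultimately show "card (C \<union> D) = k + 1" using CD by simp
  qed
  have adj': "card (C \<union> D) = k + 1 \<longleftrightarrow> card (g' C \<union> g' D) = k + 1"
    if CD: "C \<in> ?W" "D \<in> ?W" for C D
  proof -
    have "star (g' C) \<inter> star (g' D) = g ` (star C \<inter> star D)"
      using inj_on_image_Int[OF bij_betw_imp_inj_on[OF bij] star_V star_V] g' CD by simp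
    moreover have "g' C = g' D \<longleftrightarrow> C = D" by (rule inj_on_eq_iff[OF inj_g' CD])
    ultimately show ?thesis
      using meet[OF CD] meet[OF conjunct1[OF g'[OF CD(1)]] conjunct1[OF g'[OF CD(2)]]] by simp
  qed
  obtain p where p: "bij_betw p X X" "\<And>C. C \<in> ?W \<Longrightarrow> g' C = p ` C"
    using step.IH[OF _ bij'] adj' step.prems(1) by auto
  have "g A = p ` A" if A: "A \<in> ?V" for A
  proof -
    have finA: "finite A" using A finsub by blast
    have "p ` A \<subseteq> g A"
    proof
      fix z assume "z \<in> p ` A"
      then obtain x where x: "x \<in> A" "z = p x" by blast
      have "A \<noteq> {x}" using A step.hyps(1) by auto
      then obtain y where y: "y \<in> A" "y \<noteq> x" using x(1) by blast
      let ?C = "A - {y}"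
      have C: "?C \<in> ?W" using A y finA by auto
      then have "A \<in> star ?C" using A by (auto simp: star_def)
      then have "g A \<in> star (g' ?C)" using g'[OF C] by blast
      then have "p ` ?C \<subseteq> g A" using p(2)[OF C] by (simp add: star_def)
      then show "z \<in> g A" using x y by blast
    qed
    moreover have "card (p ` A) = Suc k"
      using card_image[OF inj_on_subset[OF bij_betw_imp_inj_on[OF p(1)]]] A by simp
    moreover have "card (g A) = Suc k" "finite (g A)" using gV[OF A] finsub by auto
    ultimately show ?thesis using card_subset_eq by metis
  qed
  then show ?case using p(1) by blast
qed

text \<open>
  The common neighbours of \<open>A\<close> and \<open>B\<close> are the \<open>k\<close>-subsets of the complement of \<open>A \<union> B\<close>. For
  \<open>A \<noteq> B\<close> their number is largest when the union has the least possible size \<open>k + 1\<close>, and because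
  \<open>n > 2 * k\<close> it is strictly smaller for every larger union.
\<close>

lemma kneser_automorphism_preserves_johnson_adjacency:
  assumes "1 \<le> k" "2 * k < n" and g: "graph_automorphism (kneser_graph n k) g"
    and A: "A \<in> pverts (kneser_graph n k)" and B: "B \<in> pverts (kneser_graph n k)"
  shows "card (A \<union> B) = k + 1 \<longleftrightarrow> card (g A \<union> g B) = k + 1"
proof -
  let ?V = "pverts (kneser_graph n k)"
  have bij: "bij_betw g ?V ?V"
    and arcs: "\<And>A B. A \<in> ?V \<Longrightarrow> B \<in> ?V \<Longrightarrow> A \<inter> B = {} \<longleftrightarrow> g A \<inter> g B = {}"
    using g bij_betwE[of g ?V ?V] unfolding graph_automorphism_def
    by (auto simp: parcs_kneser_graph)
  define N where "N A B = {C \<in> ?V. A \<inter> C = {} \<and> B \<inter> C = {}}" for A B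
  have gV: "g C \<in> ?V" if "C \<in> ?V" for C using bij_betwE[OF bij] that by blast
  have cN: "card (N P Q) = (n - card (P \<union> Q)) choose k" if PQ: "P \<in> ?V" "Q \<in> ?V" for P Q
  proof -
    have "N P Q = {C. C \<subseteq> {1..n} - (P \<union> Q) \<and> card C = k}"
      unfolding N_def pverts_kneser_graph by blast
    moreover have "card ({1..n} - (P \<union> Q)) = n - card (P \<union> Q)"
      using PQ by (subst card_Diff_subset) (auto simp: pverts_kneser_graph intro: finite_subset)
    ultimately show ?thesis using n_subsets[of "{1..n} - (P \<union> Q)" k] by simp
  qed
  have "g ` N A B = N (g A) (g B)"
  proof
    show "g ` N A B \<subseteq> N (g A) (g B)" unfolding N_def using arcs A B gV by blast
    show "N (g A) (g B) \<subseteq> g ` N A B"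
    proof
      fix D assume D: "D \<in> N (g A) (g B)"
      then have "D \<in> g ` ?V" using bij_betw_imp_surj_on[OF bij] by (simp add: N_def)
      then obtain C where "C \<in> ?V" "D = g C" by blast
      then show "D \<in> g ` N A B" using D arcs A B by (auto simp: N_def)
    qed
  qed
  moreover have "inj_on g (N A B)"
    by (rule inj_on_subset[OF bij_betw_imp_inj_on[OF bij]]) (auto simp: N_def)
  ultimately have "card (N (g A) (g B)) = card (N A B)" using card_image by metis
  then have eq: "(n - card (A \<union> B)) choose k = (n - card (g A \<union> g B)) choose k"
    using cN A B gV by simp
  have smaller: "(n - u) choose k < (n - (k + 1)) choose k" if "k + 2 \<le> u" for u
  proof -
    obtain r where r: "k = Suc r" using \<open>1 \<le> k\<close> by (cases k) auto
    have "(n - u) choose k \<le> (n - (k + 2)) choose k"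
      by (rule binomial_right_mono) (use that in simp)
    also have "\<dots> < Suc (n - (k + 2)) choose k"
      using assms(2) by (simp add: r zero_less_binomial_iff)
    also have "Suc (n - (k + 2)) = n - (k + 1)" using assms(2) \<open>1 \<le> k\<close> by simp
    finally show ?thesis .
  qed
  have large: "card (P \<union> Q) = k + 1 \<or> k + 2 \<le> card (P \<union> Q)"
    if "P \<in> ?V" "Q \<in> ?V" "P \<noteq> Q" for P Q
  proof -
    have fin: "finite P" "finite Q" "card P = k" "card Q = k"
      using that by (auto simp: pverts_kneser_graph intro: finite_subset)
    have "P \<subset> P \<union> Q" using that(3) card_subset_eq[of P Q] fin by auto
    then have "card P < card (P \<union> Q)" using psubset_card_mono[of "P \<union> Q" P] fin by simp
    then show ?thesis using fin by linarith
  qed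
  show ?thesis
  proof (cases "A = B")
    case True
    then show ?thesis using A gV[OF A] by (simp add: pverts_kneser_graph)
  next
    case False
    then have "g A \<noteq> g B" using inj_onD[OF bij_betw_imp_inj_on[OF bij]] A B by blast
    then show ?thesis
      using large[OF A B False] large[OF gV[OF A] gV[OF B]] smaller eq by (metis less_irrefl)
  qed
qed

lemma kneser_automorphism_induced:
  assumes "1 \<le> k" "2 * k < n" "graph_automorphism (kneser_graph n k) g"
  obtains p where "bij_betw p {1..n} {1..n}" "\<And>A. A \<in> pverts (kneser_graph n k) \<Longrightarrow> g A = p ` A"
proof -
  have "\<exists>p. bij_betw p {1..n} {1..n} \<and> (\<forall>A. A \<subseteq> {1..n} \<longrightarrow> card A = k \<longrightarrow> g A = p ` A)"
  proof (rule johnson_automorphism_induced)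
    show "bij_betw g {A. A \<subseteq> {1..n} \<and> card A = k} {A. A \<subseteq> {1..n} \<and> card A = k}"
      using assms(3) by (simp add: graph_automorphism_def pverts_kneser_graph)
  qed (use assms kneser_automorphism_preserves_johnson_adjacency in
        \<open>auto simp: pverts_kneser_graph\<close>)
  then show thesis using that by (auto simp: pverts_kneser_graph)
qed

lemma graph_automorphism_image:
  assumes p: "bij_betw p {1..n} {1..n}"
  shows "graph_automorphism (kneser_graph n k) ((`) p)"
proof -
  let ?V = "pverts (kneser_graph n k)"
  have inj: "inj_on p {1..n}" using bij_betw_imp_inj_on[OF p] .
  have into: "p ` A \<in> ?V" if "A \<in> ?V" for A
    using that bij_betwE[OF p] card_image[OF inj_on_subset[OF inj]]
    by (auto simp: pverts_kneser_graph image_subset_iff subset_iff)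
  have injV: "inj_on ((`) p) ?V"
    by (rule inj_onI) (use inj_on_image_eq_iff[OF inj] in \<open>auto simp: pverts_kneser_graph\<close>)
  have "finite ?V" by (simp add: pverts_kneser_graph)
  then have "bij_betw ((`) p) ?V ?V"
    using endo_inj_surj[of ?V "(`) p"] injV into by (auto simp: bij_betw_def)
  moreover have "A \<inter> B = {} \<longleftrightarrow> p ` A \<inter> p ` B = {}" if "A \<in> ?V" "B \<in> ?V" for A B
    using inj_on_image_Int[OF inj, of A B] that by (auto simp: pverts_kneser_graph)
  ultimately show ?thesis
    unfolding graph_automorphism_def parcs_kneser_graph using into by blast
qed

section \<open>Determining sets as separating families\<close>

definition separates :: "'a set set \<Rightarrow> 'a set \<Rightarrow> bool" where
  "separates S X \<longleftrightarrow> (\<forall>x \<in> X. \<forall>y \<in> X. (\<forall>A \<in> S. x \<in> A \<longleftrightarrow> y \<in> A) \<longrightarrow> x = y)"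

text \<open>
  If \<open>x\<close> and \<open>y\<close> are not separated, the transposition of \<open>x\<close> and \<open>y\<close> fixes every member of \<open>S\<close> but
  moves a vertex containing \<open>x\<close> but not \<open>y\<close>. Conversely, permutations that agree on the members of a
  separating \<open>S\<close> agree at every point, since the members of \<open>S\<close> containing a point identify it.
\<close>

lemma determining_set_kneser_iff:
  assumes "1 \<le> k" "2 * k < n"
  shows "determining_set (kneser_graph n k) S \<longleftrightarrow>
           S \<subseteq> pverts (kneser_graph n k) \<and> separates S {1..n}"
    (is "_ \<longleftrightarrow> S \<subseteq> ?V \<and> _")
proof (intro iffI conjI)
  assume det: "determining_set (kneser_graph n k) S"
  then show SV: "S \<subseteq> ?V" by (simp add: determining_set_def)
  show "separates S {1..n}"
    unfolding separates_def
  proof (intro ballI impI, rule ccontr)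
    fix x y assume x: "x \<in> {1..n}" and y: "y \<in> {1..n}"
      and same: "\<forall>A \<in> S. x \<in> A \<longleftrightarrow> y \<in> A" and "x \<noteq> y"
    let ?t = "Transposition.transpose x y"
    have "bij_betw ?t {1..n} {1..n}" using x y by simp
    then have "graph_automorphism (kneser_graph n k) ((`) ?t)"
      by (rule graph_automorphism_image)
    moreover have "graph_automorphism (kneser_graph n k) id"
      by (simp add: graph_automorphism_def)
    moreover have "\<forall>s \<in> S. ?t ` s = id s" using same by simp
    ultimately have fixed: "?t ` A = A" if "A \<in> ?V" for A
      using det that unfolding determining_set_def by (metis id_apply)
    have "k - 1 \<le> card ({1..n} - {x, y})"
      using x y \<open>x \<noteq> y\<close> assms by (simp add: card_Diff_subset)
    then obtain C where C: "C \<subseteq> {1..n} - {x, y}" "card C = k - 1" "finite C"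
      using obtain_subset_with_card_n by metis
    then have V: "insert x C \<in> ?V"
      using x assms(1) by (subst pverts_kneser_graph) (auto simp: card_insert_if)
    have "y \<in> ?t ` insert x C" by simp
    then have "y \<in> insert x C" using fixed[OF V] by blast
    then show False using C \<open>x \<noteq> y\<close> by blast
  qed
next
  assume *: "S \<subseteq> ?V \<and> separates S {1..n}"
  show "determining_set (kneser_graph n k) S"
    unfolding determining_set_def
  proof (intro conjI allI impI)
    show "S \<subseteq> ?V" using * by blast
    fix g h
    assume g: "graph_automorphism (kneser_graph n k) g"
      and h: "graph_automorphism (kneser_graph n k) h" and agree: "\<forall>s \<in> S. g s = h s"
    obtain p where p: "bij_betw p {1..n} {1..n}" "\<And>A. A \<in> ?V \<Longrightarrow> g A = p ` A"
      using kneser_automorphism_induced[OF assms g] by blast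
    obtain q where q: "bij_betw q {1..n} {1..n}" "\<And>A. A \<in> ?V \<Longrightarrow> h A = q ` A"
      using kneser_automorphism_induced[OF assms h] by blast
    have same: "p x = q x" if x: "x \<in> {1..n}" for x
    proof -
      have "p x \<in> q ` {1..n}"
        using x bij_betwE[OF p(1)] bij_betw_imp_surj_on[OF q(1)] by auto
      then obtain y where y: "y \<in> {1..n}" "p x = q y" by blast
      have "x \<in> A \<longleftrightarrow> y \<in> A" if A: "A \<in> S" for A
      proof -
        have AV: "A \<in> ?V" and sub: "A \<subseteq> {1..n}" using * A by (auto simp: pverts_kneser_graph)
        have "x \<in> A \<longleftrightarrow> p x \<in> p ` A"
          using inj_on_image_mem_iff[OF bij_betw_imp_inj_on[OF p(1)] x sub] by simp
        also have "p ` A = q ` A" using agree A p(2)[OF AV] q(2)[OF AV] by simp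
        also have "p x \<in> q ` A \<longleftrightarrow> y \<in> A"
          using inj_on_image_mem_iff[OF bij_betw_imp_inj_on[OF q(1)] y(1) sub] y(2) by simp
        finally show ?thesis .
      qed
      then show ?thesis using * x y unfolding separates_def by blast
    qed
    show "\<forall>v \<in> ?V. g v = h v"
    proof
      fix v assume v: "v \<in> ?V"
      then have "p ` v = q ` v" using same by (intro image_cong) (auto simp: pverts_kneser_graph)
      then show "g v = h v" using p(2) q(2) v by simp
    qed
  qed
qed

lemma determining_number_le_iff:
  assumes "1 \<le> k" "2 * k < n"
  shows "determining_number (kneser_graph n k) \<le> m \<longleftrightarrow>
           (\<exists>S \<subseteq> {A. A \<subseteq> {1..n} \<and> card A = k}. card S \<le> m \<and> separates S {1..n})"
proof -
  let ?P = "\<lambda>d. \<exists>S. determining_set (kneser_graph n k) S \<and> card S = d"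
  have "?P (determining_number (kneser_graph n k))"
    unfolding determining_number_def by (rule LeastI_ex) (use determining_set_pverts in blast)
  moreover have "determining_number (kneser_graph n k) \<le> d" if "?P d" for d
    unfolding determining_number_def using that by (rule Least_le)
  ultimately have "determining_number (kneser_graph n k) \<le> m \<longleftrightarrow> (\<exists>d \<le> m. ?P d)"
    using order_trans by blast
  then show ?thesis
    unfolding determining_set_kneser_iff[OF assms] pverts_kneser_graph by auto
qed

section \<open>Families of subsets with prescribed degrees\<close>

definition degree :: "'a set set \<Rightarrow> 'a \<Rightarrow> nat" where
  "degree F x = card {A \<in> F. x \<in> A}"

lemma double_count:
  assumes "finite X" "finite Y"
  shows "(\<Sum>x \<in> X. card {y \<in> Y. R x y}) = (\<Sum>y \<in> Y. card {x \<in> X. R x y})"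
proof -
  have "(\<Sum>x \<in> X. card {y \<in> Y. R x y}) = (\<Sum>x \<in> X. \<Sum>y \<in> Y. of_bool (R x y))"
    using assms by (simp add: Int_def)
  also have "\<dots> = (\<Sum>y \<in> Y. \<Sum>x \<in> X. of_bool (R x y))" by (rule sum.swap)
  also have "\<dots> = (\<Sum>y \<in> Y. card {x \<in> X. R x y})" using assms by (simp add: Int_def)
  finally show ?thesis .
qed

lemma sum_degree:
  assumes "finite I" "F \<subseteq> Pow I"
  shows "(\<Sum>x \<in> I. degree F x) = (\<Sum>A \<in> F. card A)"
proof -
  have "finite F" using assms finite_subset by blast
  then have "(\<Sum>x \<in> I. degree F x) = (\<Sum>A \<in> F. card {x \<in> I. x \<in> A})"
    unfolding degree_def using assms(1) by (intro double_count)
  also have "\<dots> = (\<Sum>A \<in> F. card A)"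
    by (rule sum.cong) (use assms(2) in \<open>auto intro: arg_cong[where f = card]\<close>)
  finally show ?thesis .
qed

lemma degree_replace:
  assumes "finite F" "A \<in> F" "B \<notin> F"
  shows "degree (insert B (F - {A})) x + of_bool (x \<in> A) = degree F x + of_bool (x \<in> B)"
proof -
  have eq: "{C \<in> insert B (F - {A}). x \<in> C} =
      (if x \<in> B then {B} else {}) \<union> ({C \<in> F. x \<in> C} - {A})"
    using assms by auto
  have fin: "finite {C \<in> F. x \<in> C}" using assms by simp
  have "x \<in> A \<Longrightarrow> 0 < card {C \<in> F. x \<in> C}" using assms fin card_gt_0_iff by blast
  then show ?thesis
    unfolding degree_def eq using assms fin by (auto simp: card_Diff_singleton_if card_insert_if)
qed

lemma card_replace:
  assumes "finite F" "A \<in> F" "B \<notin> F"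
  shows "card (insert B (F - {A})) = card F"
proof -
  have "0 < card F" using assms card_gt_0_iff by blast
  then show ?thesis using assms by simp
qed

text \<open>
  Otherwise inserting \<open>x\<close> would map the members without \<open>x\<close> injectively to the members with \<open>x\<close>.
\<close>

lemma exists_raisable_set:
  assumes "finite F" "2 * degree F x < card F"
  obtains A where "A \<in> F" "x \<notin> A" "insert x A \<notin> F"
proof (rule ccontr)
  assume "\<not> thesis"
  then have "insert x ` {A \<in> F. x \<notin> A} \<subseteq> {A \<in> F. x \<in> A}" using that by blast
  moreover have "inj_on (insert x) {A \<in> F. x \<notin> A}"
    by (rule inj_onI) (auto simp: insert_ident)
  ultimately have "card {A \<in> F. x \<notin> A} \<le> degree F x"
    unfolding degree_def using assms(1) by (intro card_inj_on_le) auto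
  moreover have "card F = degree F x + card {A \<in> F. x \<notin> A}"
    unfolding degree_def using assms(1)
    by (subst card_Un_disjoint[symmetric]) (auto intro: arg_cong[where f = card])
  ultimately show False using assms(2) by simp
qed

text \<open>
  Otherwise trading \<open>y\<close> for \<open>x\<close> would map the members that contain \<open>y\<close> but not \<open>x\<close> injectively to
  those that contain \<open>x\<close> but not \<open>y\<close>.
\<close>

lemma exists_exchangeable_set:
  assumes "finite F" "degree F x < degree F y"
  obtains A where "A \<in> F" "y \<in> A" "x \<notin> A" "insert x (A - {y}) \<notin> F"
proof (rule ccontr)
  assume "\<not> thesis"
  then have "(\<lambda>A. insert x (A - {y})) ` {A \<in> F. y \<in> A \<and> x \<notin> A} \<subseteq> {A \<in> F. x \<in> A \<and> y \<notin> A}"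
    using that assms(2) by fastforce
  moreover have "inj_on (\<lambda>A. insert x (A - {y})) {A \<in> F. y \<in> A \<and> x \<notin> A}"
    by (rule inj_on_inverseI[where g = "\<lambda>B. insert y (B - {x})"]) auto
  ultimately have "card {A \<in> F. y \<in> A \<and> x \<notin> A} \<le> card {A \<in> F. x \<in> A \<and> y \<notin> A}"
    using assms(1) by (intro card_inj_on_le) auto
  moreover have "degree F u = card {A \<in> F. u \<in> A \<and> v \<in> A} + card {A \<in> F. u \<in> A \<and> v \<notin> A}" for u v
    unfolding degree_def using assms(1)
    by (subst card_Un_disjoint[symmetric]) (auto intro: arg_cong[where f = card])
  from this[of x y] this[of y x]
  have "degree F x = card {A \<in> F. x \<in> A \<and> y \<in> A} + card {A \<in> F. x \<in> A \<and> y \<notin> A}"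
    "degree F y = card {A \<in> F. x \<in> A \<and> y \<in> A} + card {A \<in> F. y \<in> A \<and> x \<notin> A}"
    by (simp_all add: conj_commute)
  ultimately show False using assms(2) by simp
qed

text \<open>
  Among the families of \<open>n\<close> subsets of \<open>I\<close> with total size at most \<open>card I * k\<close>, take one that
  minimises the total shortfall of its degrees below \<open>k\<close>. If some degree is short, it can be increased
  by one: by trading with an element of degree above \<open>k\<close> if there is one, and otherwise by enlarging
  a member, which the total size then permits and for which \<open>2 * k < n\<close> guarantees a candidate.
  Neither move makes another element short, so this contradicts minimality. With no degree short,
  the bound on the total size forces equality everywhere.
\<close>

lemma regular_family_exists:
  assumes "finite I" "F \<subseteq> Pow I" "card F = n" "(\<Sum>A \<in> F. card A) \<le> card I * k" "2 * k < n"
  obtains F' where "F' \<subseteq> Pow I" "card F' = n" "\<And>x. x \<in> I \<Longrightarrow> degree F' x = k"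
proof -
  define P where "P F \<longleftrightarrow> F \<subseteq> Pow I \<and> card F = n \<and> (\<Sum>x \<in> I. degree F x) \<le> card I * k" for F
  \<comment> \<open>Truncated subtraction: degrees above \<open>k\<close> contribute nothing, so lowering one of them is free.\<close>
  define deficit where "deficit F = (\<Sum>x \<in> I. k - degree F x)" for F
  have "P F" using assms sum_degree[OF assms(1,2)] by (simp add: P_def)
  then obtain G where G: "P G" and least: "\<And>H. P H \<Longrightarrow> deficit G \<le> deficit H"
    using ex_has_least_nat[of P F deficit] by blast
  have finG: "finite G" using G assms(1) finite_subset unfolding P_def by blast
  have ge: "k \<le> degree G x" if x: "x \<in> I" for x
  proof (rule ccontr)
    assume "\<not> k \<le> degree G x"
    then have low: "degree G x < k" by simp
    have "\<exists>H. P H \<and> degree G x < degree H x \<and>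
        (\<forall>z \<in> I. degree G z \<le> degree H z \<or> k \<le> degree H z)"
    proof (cases "\<exists>y \<in> I. k < degree G y")
      case True
      then obtain y where y: "y \<in> I" "k < degree G y" by blast
      then have "degree G x < degree G y" using low by simp
      then obtain A where A: "A \<in> G" "y \<in> A" "x \<notin> A" "insert x (A - {y}) \<notin> G"
        using exists_exchangeable_set[OF finG] by blast
      define H where "H = insert (insert x (A - {y})) (G - {A})"
      have "x \<noteq> y" using A by blast
      have deg: "degree H z + of_bool (z = y) = degree G z + of_bool (z = x)" for z
        using degree_replace[OF finG A(1,4), of z] A \<open>x \<noteq> y\<close> unfolding H_def
        by (auto split: if_splits)
      have "(\<Sum>z \<in> I. degree H z + of_bool (z = y)) = (\<Sum>z \<in> I. degree G z + of_bool (z = x))"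
        by (simp only: deg)
      then have "(\<Sum>z \<in> I. degree H z) = (\<Sum>z \<in> I. degree G z)"
        using assms(1) x y(1) by (simp add: sum.distrib)
      moreover have "H \<subseteq> Pow I" using G A x by (auto simp: H_def P_def)
      moreover have "card H = n"
        using card_replace[OF finG A(1,4)] G by (simp add: H_def P_def)
      ultimately have "P H" using G by (simp add: P_def)
      moreover have "degree G x < degree H x" using deg[of x] \<open>x \<noteq> y\<close> by simp
      moreover have "degree G z \<le> degree H z \<or> k \<le> degree H z" for z
        using deg[of z] y(2) by (cases "z = y") auto
      ultimately show ?thesis by blast
    next
      case False
      then have le: "\<And>z. z \<in> I \<Longrightarrow> degree G z \<le> k" by force
      have "(\<Sum>z \<in> I. degree G z) < (\<Sum>z \<in> I. k)"
        by (rule sum_strict_mono_ex1) (use assms(1) le low x in auto)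
      then have total: "Suc (\<Sum>z \<in> I. degree G z) \<le> card I * k" by simp
      have "2 * degree G x < card G" using low assms(5) G by (simp add: P_def)
      then obtain A where A: "A \<in> G" "x \<notin> A" "insert x A \<notin> G"
        using exists_raisable_set[OF finG] by blast
      define H where "H = insert (insert x A) (G - {A})"
      have deg: "degree H z = degree G z + of_bool (z = x)" for z
        using degree_replace[OF finG A(1,3), of z] A unfolding H_def by (auto split: if_splits)
      have "(\<Sum>z \<in> I. degree H z) = Suc (\<Sum>z \<in> I. degree G z)"
        using assms(1) x by (simp add: deg sum.distrib)
      moreover have "H \<subseteq> Pow I" using G A x by (auto simp: H_def P_def)
      moreover have "card H = n"
        using card_replace[OF finG A(1,3)] G by (simp add: H_def P_def)
      ultimately have "P H" using total by (simp add: P_def)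
      then show ?thesis using deg by auto
    qed
    then obtain H where H: "P H" "degree G x < degree H x"
      "\<And>z. z \<in> I \<Longrightarrow> degree G z \<le> degree H z \<or> k \<le> degree H z" by blast
    have "deficit H < deficit G"
      unfolding deficit_def
    proof (rule sum_strict_mono_ex1)
      show "\<forall>z \<in> I. k - degree H z \<le> k - degree G z" using H(3) by fastforce
      show "\<exists>z \<in> I. k - degree H z < k - degree G z"
        using x low H(2) by (intro bexI[of _ x]) auto
    qed (use assms(1) in simp)
    then show False using least[OF H(1)] by simp
  qed
  have "degree G x = k" if x: "x \<in> I" for x
  proof (rule ccontr)
    assume "degree G x \<noteq> k"
    then have "k < degree G x" using ge[OF x] by simp
    then have "(\<Sum>z \<in> I. k) < (\<Sum>z \<in> I. degree G z)"
      using ge x assms(1) by (intro sum_strict_mono_ex1) auto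
    then show False using G by (simp add: P_def)
  qed
  then show thesis using that G by (auto simp: P_def)
qed

text \<open>
  A family of least total size consists of all subsets smaller than some \<open>t\<close> and some subsets of size
  \<open>t\<close>: a missing smaller set could replace a largest member. The equation expresses its total size
  through \<open>t\<close>; only the sets smaller than \<open>t\<close> contribute to the truncated sum, and all of them are
  members.
\<close>

lemma lightest_family:
  assumes "finite I" "n \<le> 2 ^ card I"
  obtains F t where "F \<subseteq> Pow I" "card F = n" "t \<le> card I"
    "(\<Sum>A \<in> F. card A) + (\<Sum>A \<in> Pow I. t - card A) = t * n"
proof -
  define P where "P F \<longleftrightarrow> F \<subseteq> Pow I \<and> card F = n" for F
  obtain F0 where "P F0"
    using obtain_subset_with_card_n[of n "Pow I"] assms by (auto simp: P_def card_Pow)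
  then obtain F where F: "P F" and least: "\<And>H. P H \<Longrightarrow> (\<Sum>A \<in> F. card A) \<le> (\<Sum>A \<in> H. card A)"
    using ex_has_least_nat[of P F0 "\<lambda>F. \<Sum>A \<in> F. card A"] by blast
  have sub: "F \<subseteq> Pow I" and cF: "card F = n" using F by (auto simp: P_def)
  have finF: "finite F" using sub assms(1) finite_subset by blast
  \<comment> \<open>Inserting \<open>0\<close> keeps the maximum meaningful for the empty family.\<close>
  define t where "t = Max (insert 0 (card ` F))"
  have le_t: "card A \<le> t" if "A \<in> F" for A
    unfolding t_def using finF that by (intro Max_ge) auto
  have t_mem: "t \<in> insert 0 (card ` F)"
    unfolding t_def using finF by (intro Max_in) auto
  then have "t \<le> card I" using sub card_mono[OF assms(1)] by auto
  have full: "B \<in> F" if B: "B \<subseteq> I" "card B < t" for B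
  proof (rule ccontr)
    assume nB: "B \<notin> F"
    obtain A where A: "A \<in> F" "card A = t" using t_mem B(2) by auto
    define H where "H = insert B (F - {A})"
    have "P H" using sub B cF card_replace[OF finF A(1) nB] by (auto simp: H_def P_def)
    moreover have "(\<Sum>C \<in> H. card C) < (\<Sum>C \<in> F. card C)"
      using finF A nB B(2) by (simp add: H_def sum.remove[OF finF A(1)])
    ultimately show False using least by (meson not_less)
  qed
  have "(\<Sum>A \<in> F. t - card A) = (\<Sum>A \<in> Pow I. t - card A)"
    by (rule sum.mono_neutral_left) (use assms(1) sub full not_less in \<open>auto, blast\<close>)
  then have "(\<Sum>A \<in> F. card A) + (\<Sum>A \<in> Pow I. t - card A) = (\<Sum>A \<in> F. card A + (t - card A))"
    by (simp add: sum.distrib)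
  also have "\<dots> = (\<Sum>A \<in> F. t)" by (rule sum.cong) (use le_t in auto)
  finally show thesis using that sub cF \<open>t \<le> card I\<close> by (simp add: mult.commute)
qed

lemma sum_Pow_card:
  assumes "finite I"
  shows "(\<Sum>A \<in> Pow I. f (card A)) = (\<Sum>j \<le> card I. (card I choose j) * (f j :: nat))"
proof -
  have "(\<Sum>A \<in> Pow I. f (card A)) = (\<Sum>j \<le> card I. \<Sum>A \<in> {A \<in> Pow I. card A = j}. f (card A))"
    by (rule sum.group[symmetric]) (use assms card_mono in auto)
  also have "\<dots> = (\<Sum>j \<le> card I. card {A. A \<subseteq> I \<and> card A = j} * f j)"
    by (rule sum.cong) auto
  finally show ?thesis using n_subsets[OF assms] by simp
qed

text \<open>
  The inequality for \<open>t\<close> is necessary since each of the \<open>n\<close> records of membership has size at least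
  \<open>t\<close> minus its shortfall below \<open>t\<close>, and the shortfalls of different records add up to at most the
  shortfalls of all subsets. For sufficiency, the inequality for the \<open>t\<close> of a lightest family bounds
  its total size by \<open>m * k\<close>, so that a family with all degrees \<open>k\<close> exists; its members, numbered by
  the points, are the records of a separating family.
\<close>

lemma separating_family_iff:
  assumes "1 \<le> k" "2 * k < n"
  shows "(\<exists>S \<subseteq> {A. A \<subseteq> {1..n} \<and> card A = k}. card S \<le> m \<and> separates S {1..n}) \<longleftrightarrow>
           n \<le> 2 ^ m \<and> (\<forall>t \<le> m. t * n \<le> m * k + (\<Sum>j \<le> m. (m choose j) * (t - j)))"
    (is "?L \<longleftrightarrow> ?R")
proof
  assume ?L
  then obtain S where S: "S \<subseteq> {A. A \<subseteq> {1..n} \<and> card A = k}" "card S \<le> m" "separates S {1..n}"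
    by blast
  have finS: "finite S" by (rule finite_subset[OF S(1)]) simp
  have "S \<noteq> {}"
  proof
    assume "S = {}"
    moreover have "1 \<in> {1..n}" "2 \<in> {1..n}" using assms by auto
    ultimately have "(1::nat) = 2" using S(3) unfolding separates_def by blast
    then show False by simp
  qed
  moreover have "\<exists>f. inj_on f S \<and> f ` S \<subseteq> {..<m}"
    using card_le_inj[OF finS, of "{..<m}"] S(2) by auto
  ultimately have "\<exists>f. f ` {..<m} = S" by (rule iffD1[OF inj_on_iff_surj])
  then obtain f where f: "f ` {..<m} = S" by blast
  \<comment> \<open>Sets are listed with repetitions if there are fewer than \<open>m\<close>, so that every record is a subset of
    the same \<open>m\<close>-element set.\<close>
  define c where "c x = {i \<in> {..<m}. x \<in> f i}" for x
  have inj: "inj_on c {1..n}"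
  proof (rule inj_onI)
    fix x y assume xy: "x \<in> {1..n}" "y \<in> {1..n}" "c x = c y"
    then have "x \<in> f i \<longleftrightarrow> y \<in> f i" if "i < m" for i using that by (auto simp: c_def)
    then have "\<forall>A \<in> S. x \<in> A \<longleftrightarrow> y \<in> A" unfolding f[symmetric] by simp
    then show "x = y" using S(3) xy unfolding separates_def by blast
  qed
  have cn: "card (c ` {1..n}) = n" using card_image[OF inj] by simp
  have sub: "c ` {1..n} \<subseteq> Pow {..<m}" by (auto simp: c_def)
  have "n \<le> 2 ^ m" using card_mono[OF _ sub] cn by (simp add: card_Pow)
  moreover have "t * n \<le> m * k + (\<Sum>j \<le> m. (m choose j) * (t - j))" for t
  proof -
    have "(\<Sum>x \<in> {1..n}. card (c x)) = (\<Sum>i < m. card {x \<in> {1..n}. x \<in> f i})"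
      unfolding c_def by (rule double_count) auto
    also have "\<dots> = (\<Sum>i < m. k)"
    proof (rule sum.cong)
      fix i assume "i \<in> {..<m}"
      then have "f i \<subseteq> {1..n}" "card (f i) = k" using f S(1) by blast+
      moreover from this(1) have "{x \<in> {1..n}. x \<in> f i} = f i" by blast
      ultimately show "card {x \<in> {1..n}. x \<in> f i} = k" by simp
    qed simp
    finally have total: "(\<Sum>A \<in> c ` {1..n}. card A) = m * k"
      by (subst sum.reindex[OF inj]) simp
    have "t * n = (\<Sum>A \<in> c ` {1..n}. t)" using cn by simp
    also have "\<dots> \<le> (\<Sum>A \<in> c ` {1..n}. card A + (t - card A))" by (rule sum_mono) simp
    also have "\<dots> = m * k + (\<Sum>A \<in> c ` {1..n}. t - card A)" by (simp only: sum.distrib total)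
    also have "\<dots> \<le> m * k + (\<Sum>A \<in> Pow {..<m}. t - card A)"
      using sub by (intro add_left_mono sum_mono2) auto
    finally show ?thesis using sum_Pow_card[of "{..<m}" "\<lambda>j. t - j"] by simp
  qed
  ultimately show ?R by blast
next
  assume R: ?R
  obtain F t where F: "F \<subseteq> Pow {..<m}" "card F = n" "t \<le> m"
    "(\<Sum>A \<in> F. card A) + (\<Sum>A \<in> Pow {..<m}. t - card A) = t * n"
    using lightest_family[of "{..<m}" n] R by auto
  have "t * n \<le> m * k + (\<Sum>A \<in> Pow {..<m}. t - card A)"
    using R F(3) sum_Pow_card[of "{..<m}" "\<lambda>j. t - j"] by simp
  then have "(\<Sum>A \<in> F. card A) \<le> card {..<m} * k" using F(4) by simp
  then obtain G where G: "G \<subseteq> Pow {..<m}" "card G = n" "\<And>i. i < m \<Longrightarrow> degree G i = k"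
    using regular_family_exists[OF finite_lessThan F(1,2) _ assms(2)] by auto
  have "finite G" using G(1) finite_subset by blast
  then obtain c where c: "bij_betw c {1..n} G"
    using finite_same_card_bij[of "{1..n}" G] G(2) by auto
  define f where "f i = {x \<in> {1..n}. i \<in> c x}" for i
  have "card (f i) = k" if "i < m" for i
  proof -
    have "c ` f i = {A \<in> G. i \<in> A}"
      using bij_betw_imp_surj_on[OF c] by (auto simp: f_def)
    moreover have "inj_on c (f i)"
      by (rule inj_on_subset[OF bij_betw_imp_inj_on[OF c]]) (auto simp: f_def)
    ultimately show ?thesis using card_image[of c "f i"] G(3)[OF that] by (simp add: degree_def)
  qed
  then have "f ` {..<m} \<subseteq> {A. A \<subseteq> {1..n} \<and> card A = k}" by (auto simp: f_def)
  moreover have "card (f ` {..<m}) \<le> m" using card_image_le[of "{..<m}" f] by simp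
  moreover have "separates (f ` {..<m}) {1..n}"
    unfolding separates_def
  proof (intro ballI impI)
    fix x y assume xy: "x \<in> {1..n}" "y \<in> {1..n}" and "\<forall>A \<in> f ` {..<m}. x \<in> A \<longleftrightarrow> y \<in> A"
    then have "i \<in> c x \<longleftrightarrow> i \<in> c y" if "i < m" for i using that by (auto simp: f_def)
    moreover have "c x \<subseteq> {..<m}" "c y \<subseteq> {..<m}" using G(1) bij_betwE[OF c] xy by blast+
    ultimately have "c x = c y" by blast
    then show "x = y" using inj_onD[OF bij_betw_imp_inj_on[OF c]] xy by blast
  qed
  ultimately show ?L by blast
qed

section \<open>The pairs with determining number five\<close>

text \<open>
  The inequality for \<open>t = m\<close> reads \<open>n \<le> k + 2 ^ (m - 1)\<close>; together with \<open>2 * k < n\<close> it implies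
  \<open>n \<le> 2 ^ m\<close>, which therefore has no counterpart on the right.
\<close>

lemma separating_condition_four:
  fixes n k :: nat
  assumes "2 * k < n"
  shows "(n \<le> 2 ^ 4 \<and> (\<forall>t \<le> 4. t * n \<le> 4 * k + (\<Sum>j \<le> 4. (4 choose j) * (t - j)))) \<longleftrightarrow>
    n \<le> 4 * k + 1 \<and> n \<le> 2 * k + 3 \<and> 3 * n \<le> 4 * k + 17 \<and> n \<le> k + 8"
proof -
  have atMost: "{..4} = {0, 1, 2, 3, 4::nat}" by auto
  moreover have "4 choose 2 = 6" "4 choose 3 = 4" by (simp_all add: numeral_eq_Suc)
  ultimately have sum: "(\<Sum>j \<le> 4. (4 choose j) * (t - j)) =
      t + 4 * (t - 1) + 6 * (t - 2) + 4 * (t - 3) + (t - 4)" for t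
    by simp
  have "(\<forall>t \<in> {..4}. Q t) \<longleftrightarrow> Q 0 \<and> Q 1 \<and> Q 2 \<and> Q 3 \<and> Q 4" for Q :: "nat \<Rightarrow> bool"
    by (simp add: atMost)
  from this[of "\<lambda>t. t * n \<le> 4 * k + (\<Sum>j \<le> 4. (4 choose j) * (t - j))"] show ?thesis
    using assms by (auto simp: sum)
qed

lemma separating_condition_five:
  fixes n k :: nat
  assumes "2 * k < n"
  shows "(n \<le> 2 ^ 5 \<and> (\<forall>t \<le> 5. t * n \<le> 5 * k + (\<Sum>j \<le> 5. (5 choose j) * (t - j)))) \<longleftrightarrow>
    n \<le> 5 * k + 1 \<and> 2 * n \<le> 5 * k + 7 \<and> 3 * n \<le> 5 * k + 23 \<and> 4 * n \<le> 5 * k + 49 \<and> n \<le> k + 16"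
proof -
  have atMost: "{..5} = {0, 1, 2, 3, 4, 5::nat}" by auto
  moreover have "5 choose 2 = 10" "5 choose 3 = 10" "5 choose 4 = 5" by (simp_all add: numeral_eq_Suc)
  ultimately have sum: "(\<Sum>j \<le> 5. (5 choose j) * (t - j)) =
      t + 5 * (t - 1) + 10 * (t - 2) + 10 * (t - 3) + 5 * (t - 4) + (t - 5)" for t
    by simp
  have "(\<forall>t \<in> {..5}. Q t) \<longleftrightarrow> Q 0 \<and> Q 1 \<and> Q 2 \<and> Q 3 \<and> Q 4 \<and> Q 5" for Q :: "nat \<Rightarrow> bool"
    by (simp add: atMost)
  from this[of "\<lambda>t. t * n \<le> 5 * k + (\<Sum>j \<le> 5. (5 choose j) * (t - j))"] show ?thesis
    using assms by (auto simp: sum)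
qed

text \<open>
  From \<open>2 * k < n \<le> k + 16\<close> one gets \<open>k < 16\<close>; for each such \<open>k\<close> the inequalities cut out an interval
  of values of \<open>n\<close>.
\<close>

lemma separating_condition_solutions:
  fixes n k :: nat
  shows "(1 \<le> k \<and> 2 * k < n \<and>
     (n \<le> 5 * k + 1 \<and> 2 * n \<le> 5 * k + 7 \<and> 3 * n \<le> 5 * k + 23 \<and> 4 * n \<le> 5 * k + 49 \<and> n \<le> k + 16) \<and>
    \<not> (n \<le> 4 * k + 1 \<and> n \<le> 2 * k + 3 \<and> 3 * n \<le> 4 * k + 17 \<and> n \<le> k + 8)) \<longleftrightarrow> (n, k) \<in>
    {(6, 1), (8, 2), (10, 3), (11, 3), (12, 4), (13, 4),
     (13, 5), (14, 5), (15, 5), (16, 5),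
     (14, 6), (15, 6), (16, 6), (17, 6),
     (16, 7), (17, 7), (18, 7), (19, 7),
     (17, 8), (18, 8), (19, 8), (20, 8), (21, 8),
     (19, 9), (20, 9), (21, 9), (22, 9),
     (21, 10), (22, 10), (23, 10), (24, 10),
     (23, 11), (24, 11), (25, 11), (26, 11),
     (25, 12), (26, 12), (27, 12), (27, 13), (28, 13), (29, 14), (31, 15)}"
     (is "?L \<longleftrightarrow> _ \<in> ?T")
proof
  assume L: ?L
  then have "k < 16" "1 \<le> k" by linarith+
  then have "k \<in> {1, 2, 3, 4, 5, 6, 7, 8, 9, 10, 11, 12, 13, 14, 15}"
    by (simp, presburger)
  then show "(n, k) \<in> ?T"
    using L by (elim insertE emptyE; hypsubst; simp; linarith)
next
  assume "(n, k) \<in> ?T"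
  then show ?L by (elim insertE emptyE) simp_all
qed

theorem proposition4p3:
  shows "{(n, k). k \<ge> 1 \<and> n > 2 * k \<and> determining_number (kneser_graph n k) = 5} =
    {(6, 1), (8, 2), (10, 3), (11, 3), (12, 4), (13, 4),
     (13, 5), (14, 5), (15, 5), (16, 5),
     (14, 6), (15, 6), (16, 6), (17, 6),
     (16, 7), (17, 7), (18, 7), (19, 7),
     (17, 8), (18, 8), (19, 8), (20, 8), (21, 8),
     (19, 9), (20, 9), (21, 9), (22, 9),
     (21, 10), (22, 10), (23, 10), (24, 10),
     (23, 11), (24, 11), (25, 11), (26, 11),
     (25, 12), (26, 12), (27, 12), (27, 13), (28, 13), (29, 14), (31, 15)}"
    (is "?L = ?T")
proof (rule set_eqI, clarify)
  fix n k :: nat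
  let ?d = "determining_number (kneser_graph n k)"
  let ?four = "n \<le> 4 * k + 1 \<and> n \<le> 2 * k + 3 \<and> 3 * n \<le> 4 * k + 17 \<and> n \<le> k + 8"
  let ?five = "n \<le> 5 * k + 1 \<and> 2 * n \<le> 5 * k + 7 \<and> 3 * n \<le> 5 * k + 23 \<and>
    4 * n \<le> 5 * k + 49 \<and> n \<le> k + 16"
  have "?d = 5 \<longleftrightarrow> ?five \<and> \<not> ?four" if kn: "1 \<le> k" "2 * k < n"
  proof -
    have "?d \<le> 4 \<longleftrightarrow> ?four"
      unfolding determining_number_le_iff[OF kn] separating_family_iff[OF kn]
        separating_condition_four[OF kn(2)] ..
    moreover have "?d \<le> 5 \<longleftrightarrow> ?five"
      unfolding determining_number_le_iff[OF kn] separating_family_iff[OF kn]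
        separating_condition_five[OF kn(2)] ..
    moreover have "?d = 5 \<longleftrightarrow> ?d \<le> 5 \<and> \<not> ?d \<le> 4" by linarith
    ultimately show ?thesis by blast
  qed
  then have "(n, k) \<in> ?L \<longleftrightarrow> 1 \<le> k \<and> 2 * k < n \<and> ?five \<and> \<not> ?four" by blast
  then show "(n, k) \<in> ?L \<longleftrightarrow> (n, k) \<in> ?T"
    unfolding separating_condition_solutions .
qed

end
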